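(* Let $2\le r<\infty$, let $\mathbb{F}_r$ be the free group on $r$ generators with standard symmetric generating set $S_r$, and let $\mathbb{F}_r$ act (not necessarily freely) by a Borel probability-measure-preserving action $\alpha$ on a standard probability space $(X,\mu)$. Let $\mathfrak{m}_u$ be the uniform Markov measure on $\mathbb{F}_r$. Then for every $f\in L^1(X,\mu)$, for $\mu$-a.e. $x\in X$, for all sequences $(\tau_n)$ of finite subtrees of the left Cayley graph of $\mathbb{F}_r$ (with respect to $S_r$) containing the identity such that $\lim_n \mathfrak{m}_u(\tau_n)=\infty$, we have \[ \lim_{n\to\infty}\frac{1}{\mathfrak{m}_u(\tau_n)}\sum_{w\in\tau_n} f(w\cdot x)\,\mathfrak{m}_u(w)=\overline{f}(x), \] where $\overline{f}$ is the conditional expectation of $f$ with respect to the $\sigma$-algebra of $\alpha$-invariant Borel sets.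
   Context: Elements of $\mathbb{F}_r$ are identified with reduced finite words in $S_r$ (the $r$ generators and their inverses, $|S_r|=2r$); the identity is the empty word. The left Cayley graph has vertex set $\mathbb{F}_r$ and edges between $w$ and $aw$ for $w\in\mathbb{F}_r$, $a\in S_r$. A subtree is identified with its (connected) vertex set; a subtree containing the identity is thus a set of reduced words containing the empty word and closed under taking suffixes. The uniform Markov measure is $\mathfrak{m}_u(w):=\frac{1}{2r(2r-1)^{\ell-1}}$ for each reduced word $w$ of length $\ell\ge1$, and $\mathfrak{m}_u(1_{\mathbb{F}_r}):=1$; for a set $\tau\subseteq\mathbb{F}_r$, $\mathfrak{m}_u(\tau):=\sum_{w\in\tau}\mathfrak{m}_u(w)$. *)

theory Defs
  imports "HOL-Probability.Probability" "HOL-Algebra.Group_Action"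
    "Graph_Theory.Digraph_Component"
begin

section \<open>The free group on finitely many generators\<close>

text \<open>The letter \<open>(i, True)\<close> is the \<open>i\<close>-th generator and \<open>(i, False)\<close> its inverse.\<close>

type_synonym letter = "nat \<times> bool"

definition letters :: "nat \<Rightarrow> letter set" where
  "letters r = {..<r} \<times> UNIV"

definition inv_letter :: "letter \<Rightarrow> letter" where
  "inv_letter a = (fst a, \<not> snd a)"

definition reduced_word :: "letter list \<Rightarrow> bool" where
  "reduced_word w \<longleftrightarrow> successively (\<lambda>a b. b \<noteq> inv_letter a) w"

text \<open>Left multiplication of a reduced word by a single letter, with cancellation.\<close>

fun letter_mult :: "letter \<Rightarrow> letter list \<Rightarrow> letter list" where
  "letter_mult a [] = [a]"
| "letter_mult a (b # w) = (if b = inv_letter a then w else a # b # w)"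

definition free_group :: "nat \<Rightarrow> letter list monoid" where
  "free_group r =
    \<lparr>carrier = {w. set w \<subseteq> letters r \<and> reduced_word w}, mult = foldr letter_mult, one = []\<rparr>"

lemma inv_letter_inv_letter [simp]: "inv_letter (inv_letter a) = a"
  by (simp add: inv_letter_def)

lemma inv_letter_neq [simp]: "inv_letter a \<noteq> a" "a \<noteq> inv_letter a"
  by (auto simp: inv_letter_def prod_eq_iff)

lemma inv_letter_in_letters [simp]: "inv_letter a \<in> letters r \<longleftrightarrow> a \<in> letters r"
  by (auto simp: inv_letter_def letters_def mem_Times_iff)

lemma reduced_Nil [simp]: "reduced_word []"
  by (simp add: reduced_word_def)

lemma reduced_ConsD: "reduced_word (a # w) \<Longrightarrow> reduced_word w"
  by (cases w) (auto simp: reduced_word_def)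

lemma letter_mult_reduced: "reduced_word w \<Longrightarrow> reduced_word (letter_mult a w)"
  by (cases w) (auto simp: reduced_word_def dest: reduced_ConsD[unfolded reduced_word_def])

lemma set_letter_mult: "set (letter_mult a w) \<subseteq> insert a (set w)"
  by (cases w) auto

lemma letter_mult_inv: "reduced_word w \<Longrightarrow> letter_mult a (letter_mult (inv_letter a) w) = w"
proof (cases w)
  case (Cons b v)
  assume "reduced_word w"
  then show ?thesis using Cons by (cases v) (auto simp: reduced_word_def)
qed simp

lemma foldr_letter_mult_reduced: "reduced_word w \<Longrightarrow> reduced_word (foldr letter_mult u w)"
  by (induction u) (auto intro: letter_mult_reduced)

lemma set_foldr_letter_mult: "set (foldr letter_mult u w) \<subseteq> set u \<union> set w"
  using set_letter_mult by (induction u) fastforce+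

lemma letter_mult_foldr:
  assumes "reduced_word w"
  shows "foldr letter_mult (letter_mult a v) w = letter_mult a (foldr letter_mult v w)"
proof (cases v)
  case (Cons b v')
  have "reduced_word (foldr letter_mult v' w)"
    using assms by (rule foldr_letter_mult_reduced)
  then show ?thesis using Cons by (auto simp: letter_mult_inv)
qed simp

lemma foldr_letter_mult_assoc:
  "reduced_word w \<Longrightarrow>
    foldr letter_mult (foldr letter_mult u v) w = foldr letter_mult u (foldr letter_mult v w)"
  by (induction u) (auto simp: letter_mult_foldr)

lemma foldr_letter_mult_Nil: "reduced_word w \<Longrightarrow> foldr letter_mult w [] = w"
proof (induction w)
  case (Cons a w)
  then show ?case by (cases w) (auto simp: reduced_word_def dest: reduced_ConsD)
qed simp

lemma group_free_group: "group (free_group r)"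
proof (rule groupI)
  fix x assume x: "x \<in> carrier (free_group r)"
  define y where "y = foldr letter_mult (rev (map inv_letter x)) []"
  have "y \<in> carrier (free_group r)"
    using x set_foldr_letter_mult[of "rev (map inv_letter x)" "[]"]
    by (fastforce simp: free_group_def y_def intro: foldr_letter_mult_reduced)
  moreover have "foldr letter_mult (rev (map inv_letter w)) (foldr letter_mult w v) = v"
    if "reduced_word v" for w v
    using that
  proof (induction w arbitrary: v)
    case (Cons a w)
    then show ?case
      using letter_mult_inv[of "foldr letter_mult w v" "inv_letter a"]
      by (auto simp: foldr_letter_mult_reduced)
  qed simp
  then have "foldr letter_mult y x = []"
    using x foldr_letter_mult_assoc[of x "rev (map inv_letter x)" "[]"]
    by (simp add: y_def free_group_def) (metis foldr_letter_mult_Nil reduced_Nil)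
  ultimately show "\<exists>y\<in>carrier (free_group r). y \<otimes>\<^bsub>free_group r\<^esub> x = \<one>\<^bsub>free_group r\<^esub>"
    by (auto simp: free_group_def)
qed (use set_foldr_letter_mult in
    \<open>fastforce simp: free_group_def foldr_letter_mult_assoc intro: foldr_letter_mult_reduced\<close>)+


section \<open>Subtrees of the left Cayley graph\<close>

text \<open>Every undirected edge is represented by its two orientations.\<close>

definition left_cayley :: "nat \<Rightarrow> letter list pair_pre_digraph" where
  "left_cayley r =
    \<lparr>pverts = carrier (free_group r),
     parcs = {(w, [a] \<otimes>\<^bsub>free_group r\<^esub> w) | w a. w \<in> carrier (free_group r) \<and> a \<in> letters r}\<rparr>"

text \<open>As the Cayley graph is a tree, its subtrees are its connected induced subgraphs.
  \<^const>\<open>Digraph_Component.connected\<close> includes nonemptiness.\<close>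

definition subtree :: "nat \<Rightarrow> letter list set \<Rightarrow> bool" where
  "subtree r \<tau> \<longleftrightarrow> \<tau> \<subseteq> carrier (free_group r) \<and>
     Digraph_Component.connected (induce_subgraph (with_proj (left_cayley r)) \<tau>)"

lemma subtree_iff_suffix_closed:
  assumes "\<tau> \<subseteq> carrier (free_group r)" "[] \<in> \<tau>"
  shows "subtree r \<tau> \<longleftrightarrow> (\<forall>a w. a # w \<in> \<tau> \<longrightarrow> w \<in> \<tau>)"
proof -
  define E where
    "E = {(w, letter_mult a w) | w a. a \<in> letters r \<and> w \<in> \<tau> \<and> letter_mult a w \<in> \<tau>}"
  let ?H = "mk_symmetric (induce_subgraph (with_proj (left_cayley r)) \<tau>)"
  have E_iff: "(u, v) \<in> E \<longleftrightarrow> (\<exists>a\<in>letters r. u \<in> \<tau> \<and> v \<in> \<tau> \<and> v = letter_mult a u)" for u v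
    by (auto simp: E_def)
  have E_sym: "(v, u) \<in> E" if uv: "(u, v) \<in> E" for u v
  proof -
    obtain a where a: "a \<in> letters r" "u \<in> \<tau>" "v \<in> \<tau>" "v = letter_mult a u"
      using uv by (auto simp: E_iff)
    have "reduced_word u" using a assms by (auto simp: free_group_def)
    then have "letter_mult (inv_letter a) v = u"
      using letter_mult_inv[of u "inv_letter a"] a by simp
    then show ?thesis using a by (auto simp: E_iff intro!: bexI[of _ "inv_letter a"])
  qed
  have arcs: "{e \<in> parcs (left_cayley r). fst e \<in> \<tau> \<and> snd e \<in> \<tau>} = E"
  proof -
    have "[a] \<otimes>\<^bsub>free_group r\<^esub> w = letter_mult a w" for a w
      by (simp add: free_group_def)
    then have arc: "(u, v) \<in> parcs (left_cayley r) \<longleftrightarrow>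
        (\<exists>a\<in>letters r. u \<in> carrier (free_group r) \<and> v = letter_mult a u)" for u v
      unfolding left_cayley_def by (simp only: pair_pre_digraph.simps mem_Collect_eq) blast
    show ?thesis
    proof (rule Set.set_eqI)
      fix e :: "letter list \<times> letter list"
      obtain u v where e: "e = (u, v)" by (cases e)
      show "e \<in> {e \<in> parcs (left_cayley r). fst e \<in> \<tau> \<and> snd e \<in> \<tau>} \<longleftrightarrow> e \<in> E"
        unfolding e mem_Collect_eq fst_conv snd_conv E_iff arc using assms(1) by blast
    qed
  qed
  have parcs: "parcs ?H = E"
  proof -
    have "parcs ?H = (\<Union>e\<in>E. {(fst e, snd e), (snd e, fst e)})"
      by (simp add: mk_symmetric_def induce_subgraph_def arcs)
    also have "\<dots> = E" using E_sym by auto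
    finally show ?thesis .
  qed
  have verts: "pverts ?H = \<tau>"
    by (simp add: mk_symmetric_def)
  have conn: "subtree r \<tau> \<longleftrightarrow> (\<forall>u\<in>\<tau>. \<forall>v\<in>\<tau>. (u, v) \<in> rtrancl_on \<tau> E)"
    using assms
    by (auto simp: subtree_def Digraph_Component.connected_def strongly_connected_def reachable_def
        verts parcs)
  show ?thesis
  proof
    assume "subtree r \<tau>"
    have suff: "\<forall>p a s. u = p @ a # s \<longrightarrow> s \<in> \<tau>" if "([], u) \<in> rtrancl_on \<tau> E" for u
      using that
    proof (induction rule: rtrancl_on_induct)
      case (step u v)
      then obtain a where a: "u \<in> \<tau>" "v = letter_mult a u" by (auto simp: E_iff)
      show ?case
      proof (intro allI impI)
        fix p b s assume v: "v = p @ b # s"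
        show "s \<in> \<tau>"
        proof (cases "v = a # u")
          case True
          show ?thesis
          proof (cases p)
            case Nil
            with v True a show ?thesis by simp
          next
            case (Cons c p')
            then have "u = p' @ b # s" using v True by simp
            then show ?thesis using step.IH by blast
          qed
        next
          case False
          then obtain c where "u = c # v" using a by (cases u) (auto split: if_splits)
          then have "u = (c # p) @ b # s" using v by simp
          then show ?thesis using step.IH by blast
        qed
      qed
    qed (auto)
    show "\<forall>a w. a # w \<in> \<tau> \<longrightarrow> w \<in> \<tau>"
      using suff conn \<open>subtree r \<tau>\<close> assms by (metis append_Nil)
  next
    assume cl: "\<forall>a w. a # w \<in> \<tau> \<longrightarrow> w \<in> \<tau>"
    have down: "(w, []) \<in> rtrancl_on \<tau> E \<and> ([], w) \<in> rtrancl_on \<tau> E" if "w \<in> \<tau>" for w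
      using that
    proof (induction w)
      case (Cons a w)
      then have w: "w \<in> \<tau>" using cl by blast
      have aw: "a \<in> letters r" "reduced_word (a # w)"
        using Cons.prems assms by (auto simp: free_group_def)
      then have "letter_mult a w = a # w"
        by (cases w) (auto simp: reduced_word_def)
      then have "(w, a # w) \<in> E" using w aw Cons.prems unfolding E_iff by metis
      then show ?case using Cons w E_sym
        by (meson converse_rtrancl_on_into_rtrancl_on rtrancl_on_into_rtrancl_on)
    qed (use assms in auto)
    then show "subtree r \<tau>"
      unfolding conn by (meson rtrancl_on_trans)
  qed
qed


section \<open>The uniform Markov measure\<close>

definition markov_u :: "nat \<Rightarrow> letter list \<Rightarrow> real" where
  "markov_u r w =
    (if w = [] then 1 else 1 / (2 * real r * (2 * real r - 1) ^ (length w - 1)))"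

text \<open>Only meaningful for finite \<open>\<tau>\<close>.\<close>

definition markov_u_set :: "nat \<Rightarrow> letter list set \<Rightarrow> real" where
  "markov_u_set r \<tau> = (\<Sum>w\<in>\<tau>. markov_u r w)"


section \<open>Probability-measure-preserving actions\<close>

definition standard_borel :: "'x measure \<Rightarrow> bool" where
  "standard_borel M \<longleftrightarrow>
    (\<exists>T. topspace T = space M \<and> completely_metrizable_space T \<and> second_countable T \<and>
         sets M = sigma_sets (space M) {U. openin T U})"

definition pmp_action :: "('g, 'm) monoid_scheme \<Rightarrow> 'x measure \<Rightarrow> ('g \<Rightarrow> 'x \<Rightarrow> 'x) \<Rightarrow> bool" where
  "pmp_action G M \<alpha> \<longleftrightarrow> group_action G (space M) \<alpha> \<and>
     (\<forall>g\<in>carrier G. \<alpha> g \<in> measurable M M \<and> distr M M (\<alpha> g) = M)"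

text \<open>The \<open>\<sigma>\<close>-algebra of invariant measurable sets; the measure carried by this object is irrelevant.\<close>

definition invariant_algebra ::
    "('g, 'm) monoid_scheme \<Rightarrow> 'x measure \<Rightarrow> ('g \<Rightarrow> 'x \<Rightarrow> 'x) \<Rightarrow> 'x measure" where
  "invariant_algebra G M \<alpha> =
    sigma (space M) {A \<in> sets M. \<forall>g\<in>carrier G. \<alpha> g ` A = A}"

lemma subalgebra_invariant_algebra: "subalgebra M (invariant_algebra G M \<alpha>)"
proof -
  have "{A \<in> sets M. \<forall>g\<in>carrier G. \<alpha> g ` A = A} \<subseteq> Pow (space M)"
    using sets.space_closed by auto
  moreover have "sigma_sets (space M) {A \<in> sets M. \<forall>g\<in>carrier G. \<alpha> g ` A = A} \<subseteq> sets M"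
    by (rule sets.sigma_sets_subset) auto
  ultimately show ?thesis
    by (simp add: subalgebra_def invariant_algebra_def space_measure_of_conv sets_measure_of)
qed

lemma sets_invariant_algebra:
  assumes "pmp_action G M \<alpha>"
  shows "sets (invariant_algebra G M \<alpha>) = {A \<in> sets M. \<forall>g\<in>carrier G. \<alpha> g ` A = A}"
proof -
  let ?C = "{A \<in> sets M. \<forall>g\<in>carrier G. \<alpha> g ` A = A}"
  have bij: "bij_betw (\<alpha> g) (space M) (space M)" if "g \<in> carrier G" for g
    using assms that group_action.bij_prop0[of G "space M" \<alpha> g] by (auto simp: pmp_action_def Bij_def)
  have "sigma_algebra (space M) ?C"
    unfolding sigma_algebra_iff2
  proof (intro conjI ballI allI impI)
    show "?C \<subseteq> Pow (space M)" using sets.space_closed by auto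
    show "{} \<in> ?C" by simp
    fix A assume A: "A \<in> ?C"
    have "\<alpha> g ` (space M - A) = space M - A" if "g \<in> carrier G" for g
      using A bij[OF that] that sets.sets_into_space[of A M]
        inj_on_image_set_diff[of "\<alpha> g" "space M" "space M" A]
      by (auto simp: bij_betw_def)
    then show "space M - A \<in> ?C" using A by auto
  next
    fix A :: "nat \<Rightarrow> _" assume "range A \<subseteq> ?C"
    then show "(\<Union>i. A i) \<in> ?C" by (auto simp: image_UN subset_iff)
  qed
  moreover have "?C \<subseteq> Pow (space M)" using sets.space_closed by auto
  ultimately show ?thesis
    by (simp add: invariant_algebra_def sigma_algebra.sigma_sets_eq)
qed

end

theory Submission
  imports Defs
begin

text \<open>The idea is to remember, besides the current point \<open>x\<close>, the last letter \<open>b\<close> that was applied.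
  From the state \<open>(b, x)\<close> one may continue with any of the \<open>q = 2r - 1\<close> letters \<open>a\<close> that do not cancel
  \<open>b\<close>, and move to \<open>(a, a x)\<close>; as the action preserves \<open>\<mu>\<close>, the Markov operator that averages over
  these \<open>q\<close> states preserves the product of counting measure and \<open>\<mu>\<close>. For each letter \<open>b\<close>, the words
  of a finite subtree of the Cayley graph that do not cancel \<open>b\<close> form a tree of this process starting
  with \<open>b\<close>, and the Markov weighted sum over the subtree is the mean over \<open>b\<close> of their sums with weights \<open>q\<^sup>-\<^sup>|\<^sup>w\<^sup>|\<close> (\<open>sum_markov_u_eq_average\<close>).

  For these trees the largest possible sum of a function \<open>h\<close>, over all trees of words shorter
  than \<open>n\<close>, including the empty tree, solves an optimal stopping problem and satisfies the recursion
  \<open>G\<^sub>0 = 0\<close>, \<open>G\<^sub>n\<^sub>+\<^sub>1 = max(0, h + P G\<^sub>n)\<close>, with \<open>P\<close> the Markov operator. Hopf's argument applies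
  verbatim: where \<open>G\<^sub>n > 0\<close> we have \<open>G\<^sub>n \<le> h + P G\<^sub>n\<close>, elsewhere \<open>G\<^sub>n = 0 \<le> P G\<^sub>n\<close>, and \<open>P\<close> preserves
  the integral, so the integral of \<open>h\<close> over \<open>{G\<^sub>n > 0}\<close> is nonnegative (\<open>maximal_inequality\<close>).

  Now take \<open>h = u - c\<close> with \<open>c > 0\<close>, \<open>u = f - g\<close> and \<open>g\<close> the conditional expectation of \<open>f\<close>. If a
  state has a successor at which the sequence \<open>G\<^sub>n\<close> is unbounded, then it is unbounded at the state
  itself. Since the dynamics preserves measure, this inclusion is an equality up to null sets, which
  makes unboundedness independent of the letter and invariant under the group (\<open>AE_explosive_orbit\<close>).
  Hence up to null sets it happens on an invariant set \<open>D\<close>, to which Hopf's argument can be restricted;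
  it shows that the integral of \<open>u - c\<close> over \<open>D\<close> is nonnegative. The integral of \<open>u\<close> over \<open>D\<close> is \<open>0\<close>,
  so \<open>D\<close> is null (\<open>AE_not_explosive\<close>).

  Therefore almost every \<open>x\<close> admits a bound \<open>C\<close> such that the weighted sum of \<open>u\<close> over every tree
  \<open>\<tau>\<close> is at most \<open>c m(\<tau>) + C\<close> (\<open>AE_tree_sum_bound\<close>). The same holds for \<open>-u\<close>, and since \<open>g\<close> is
  constant on orbits, dividing by \<open>m(\<tau>)\<close> and letting \<open>m(\<tau>)\<close> tend to infinity yields the claim, for all
  sequences of trees at once.\<close>

section \<open>Letters and reduced words\<close>

lemma finite_letters: "finite (letters r)"
  by (simp add: letters_def)

lemma card_letters: "card (letters r) = 2 * r"
  by (simp add: letters_def card_cartesian_product UNIV_bool)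

definition next_letters :: "nat \<Rightarrow> letter \<Rightarrow> letter set" where
  "next_letters r b = letters r - {inv_letter b}"

lemma next_letters_iff: "a \<in> next_letters r b \<longleftrightarrow> a \<in> letters r \<and> a \<noteq> inv_letter b"
  by (auto simp: next_letters_def)

lemma finite_next_letters: "finite (next_letters r b)"
  by (simp add: next_letters_def finite_letters)

lemma card_next_letters:
  assumes "b \<in> letters r"
  shows "real (card (next_letters r b)) = 2 * real r - 1"
proof -
  have "card (letters r) > 0"
    using assms finite_letters card_gt_0_iff by blast
  then show ?thesis
    using assms by (simp add: next_letters_def card_Diff_singleton card_letters of_nat_diff)
qed

lemma next_letters_swap: "b \<in> letters r \<Longrightarrow> a \<in> next_letters r b \<Longrightarrow> b \<in> next_letters r a"
  by (auto simp: next_letters_iff)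

text \<open>Two letters exclude at most two of the \<open>2r \<ge> 4\<close> continuations. This is where the assumption
  that the group is not cyclic enters: it makes the process that remembers the last letter
  forget it again.\<close>

lemma obtain_common_next_letter:
  assumes "2 \<le> r"
  obtains c where "c \<in> next_letters r a" "c \<in> next_letters r b"
proof -
  have "card {inv_letter a, inv_letter b} < card (letters r)"
    using assms card_insert_le_m1[of 2 "{inv_letter b}" "inv_letter a"] by (simp add: card_letters)
  then have "\<not> letters r \<subseteq> {inv_letter a, inv_letter b}"
    by (metis card_mono finite.emptyI finite.insertI linorder_not_less)
  then show ?thesis using that by (auto simp: next_letters_iff)
qed

lemma Cons_in_free_groupD:
  "a # w \<in> carrier (free_group r) \<Longrightarrow> a \<in> letters r \<and> w \<in> carrier (free_group r)"
  by (auto simp: free_group_def dest: reduced_ConsD)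

lemma singleton_in_free_group: "a \<in> letters r \<Longrightarrow> [a] \<in> carrier (free_group r)"
  by (simp add: free_group_def reduced_word_def)

lemma Nil_in_free_group: "[] \<in> carrier (free_group r)"
  by (simp add: free_group_def)

lemma mult_append:
  assumes "u @ v \<in> carrier (free_group r)"
  shows "u \<otimes>\<^bsub>free_group r\<^esub> v = u @ v"
proof -
  have red: "reduced_word (u @ v)" "reduced_word v"
    using assms by (auto simp: free_group_def reduced_word_def successively_append_iff)
  have "u @ v = foldr letter_mult (u @ v) []"
    using foldr_letter_mult_Nil[OF red(1)] by simp
  also have "\<dots> = foldr letter_mult u v"
    using foldr_letter_mult_Nil[OF red(2)] by simp
  finally show ?thesis by (simp add: free_group_def)
qed

section \<open>Trees below a given last letter\<close>

text \<open>Words that may be written in front of the letter \<open>b\<close> without cancellation, closed under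
  suffixes. The empty set is included, because a branch of a tree may be empty.\<close>

definition backward_tree :: "nat \<Rightarrow> letter \<Rightarrow> letter list set \<Rightarrow> bool" where
  "backward_tree r b T \<longleftrightarrow> finite T \<and> (\<forall>w\<in>T. w @ [b] \<in> carrier (free_group r)) \<and>
     (\<forall>a w. a # w \<in> T \<longrightarrow> w \<in> T)"

lemma suffix_closedD: "\<forall>a w. a # w \<in> T \<longrightarrow> w \<in> T \<Longrightarrow> u @ v \<in> T \<Longrightarrow> v \<in> T"
  by (induction u) auto

text \<open>The nonempty words of a tree are grouped by their last letter, which is the letter applied
  first; each group is a tree below that letter.\<close>

lemma sum_backward_tree_split:
  fixes \<phi> :: "letter list \<Rightarrow> real"
  assumes T: "backward_tree r b T" and ne: "T \<noteq> {}"
  shows "(\<Sum>w\<in>T. \<phi> w) = \<phi> [] + (\<Sum>a\<in>next_letters r b. \<Sum>w\<in>{w. w @ [a] \<in> T}. \<phi> (w @ [a]))"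
proof -
  let ?U = "\<lambda>a. (\<lambda>w. w @ [a]) ` {w. w @ [a] \<in> T}"
  have cl: "v \<in> T" if "u @ v \<in> T" for u v
    by (rule suffix_closedD[OF _ that]) (use T in \<open>simp add: backward_tree_def\<close>)
  obtain w where "w \<in> T" using ne by blast
  then have nil: "[] \<in> T" using cl[of w "[]"] by simp
  have step: "a \<in> next_letters r b" if "w @ [a] \<in> T" for w a
  proof -
    have "(w @ [a]) @ [b] \<in> carrier (free_group r)"
      using T that unfolding backward_tree_def by blast
    then show ?thesis
      by (auto simp: free_group_def reduced_word_def successively_append_iff next_letters_iff)
  qed
  have T_eq: "T = insert [] (\<Union>a\<in>next_letters r b. ?U a)"
  proof (intro subset_antisym subsetI)
    fix w assume "w \<in> T"
    then show "w \<in> insert [] (\<Union>a\<in>next_letters r b. ?U a)"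
      using step by (cases w rule: rev_cases) auto
  qed (use nil in auto)
  have fin: "finite T" using T by (simp add: backward_tree_def)
  have finU: "finite (?U a)" for a by (rule finite_subset[OF _ fin]) auto
  have "(\<Sum>w\<in>T. \<phi> w) = \<phi> [] + (\<Sum>w\<in>(\<Union>a\<in>next_letters r b. ?U a). \<phi> w)"
    by (subst T_eq, subst sum.insert) (use finU finite_next_letters in auto)
  also have "(\<Sum>w\<in>(\<Union>a\<in>next_letters r b. ?U a). \<phi> w) = (\<Sum>a\<in>next_letters r b. \<Sum>w\<in>?U a. \<phi> w)"
    by (rule sum.UNION_disjoint) (use finU finite_next_letters in auto)
  also have "\<dots> = (\<Sum>a\<in>next_letters r b. \<Sum>w\<in>{w. w @ [a] \<in> T}. \<phi> (w @ [a]))"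
  proof (rule sum.cong[OF refl])
    fix a
    have "inj_on (\<lambda>w. w @ [a]) {w. w @ [a] \<in> T}" by (simp add: inj_on_def)
    then show "(\<Sum>w\<in>?U a. \<phi> w) = (\<Sum>w\<in>{w. w @ [a] \<in> T}. \<phi> (w @ [a]))"
      by (simp add: sum.reindex)
  qed
  finally show ?thesis .
qed

lemma backward_tree_branch:
  assumes "backward_tree r b T"
  shows "backward_tree r a {w. w @ [a] \<in> T}"
  unfolding backward_tree_def
proof (intro conjI ballI allI impI)
  have "finite ((\<lambda>w. w @ [a]) ` {w. w @ [a] \<in> T})"
    by (rule finite_subset[of _ T]) (use assms in \<open>auto simp: backward_tree_def\<close>)
  then show "finite {w. w @ [a] \<in> T}"
    by (rule finite_imageD) (auto simp: inj_on_def)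
next
  fix w assume "w \<in> {w. w @ [a] \<in> T}"
  then have "(w @ [a]) @ [b] \<in> carrier (free_group r)" using assms by (auto simp: backward_tree_def)
  then show "w @ [a] \<in> carrier (free_group r)"
    unfolding free_group_def reduced_word_def by (auto simp: successively_append_iff)
qed (use assms in \<open>auto simp: backward_tree_def\<close>)

text \<open>A nonempty reduced word \<open>w\<close> can be followed by \<open>2r - 1\<close> of the \<open>2r\<close> letters \<open>b\<close>, which accounts for
  the factor between \<open>(2r - 1)\<^sup>-\<^sup>|\<^sup>w\<^sup>|\<close> and the uniform Markov measure; the empty word can be followed by
  all of them and has weight \<open>1\<close> for both.\<close>

lemma sum_markov_u_eq_average:
  fixes g :: "letter list \<Rightarrow> real"
  assumes r: "2 \<le> r" and \<tau>: "\<tau> \<subseteq> carrier (free_group r)" "finite \<tau>"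
  shows "(\<Sum>w\<in>\<tau>. g w * markov_u r w) =
    (\<Sum>b\<in>letters r. \<Sum>w\<in>{w \<in> \<tau>. w @ [b] \<in> carrier (free_group r)}.
       g w / (2 * real r - 1) ^ length w) / (2 * real r)"
proof -
  define q where "q = 2 * real r - 1"
  have q: "q \<noteq> 0" and r0: "real r \<noteq> 0" using r by (auto simp: q_def)
  have count: "(\<Sum>b\<in>letters r. if w @ [b] \<in> carrier (free_group r) then g w / q ^ length w else 0)
      = 2 * real r * (g w * markov_u r w)" if "w \<in> \<tau>" for w
  proof -
    have w: "set w \<subseteq> letters r" "reduced_word w" using \<tau> that by (auto simp: free_group_def)
    show ?thesis
    proof (cases w rule: rev_cases)
      case Nil
      then show ?thesis
        using w by (simp add: free_group_def reduced_word_def markov_u_def card_letters)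
    next
      case (snoc v a)
      then have a: "a \<in> letters r" using w by auto
      have "w @ [b] \<in> carrier (free_group r) \<longleftrightarrow> b \<in> next_letters r a" if "b \<in> letters r" for b
        using that w snoc
        by (auto simp: free_group_def reduced_word_def successively_append_iff next_letters_iff)
      then have "(\<Sum>b\<in>letters r. if w @ [b] \<in> carrier (free_group r) then g w / q ^ length w else 0)
          = (\<Sum>b\<in>letters r. if b \<in> next_letters r a then g w / q ^ length w else 0)"
        by (intro sum.cong) auto
      also have "\<dots> = (\<Sum>b\<in>next_letters r a. g w / q ^ length w)"
        by (rule sum.mono_neutral_cong_right) (auto simp: finite_letters next_letters_iff)
      also have "\<dots> = q * (g w / q ^ length w)"
        using card_next_letters[OF a] by (simp add: q_def)
      also have "\<dots> = 2 * real r * (g w * markov_u r w)"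
        using snoc q r0 by (simp add: markov_u_def flip: q_def)
      finally show ?thesis .
    qed
  qed
  have "(\<Sum>b\<in>letters r. \<Sum>w\<in>{w \<in> \<tau>. w @ [b] \<in> carrier (free_group r)}. g w / q ^ length w)
      = (\<Sum>b\<in>letters r. \<Sum>w\<in>\<tau>. if w @ [b] \<in> carrier (free_group r) then g w / q ^ length w else 0)"
    by (simp add: sum.inter_filter \<tau>(2))
  also have "\<dots> = (\<Sum>w\<in>\<tau>. 2 * real r * (g w * markov_u r w))"
    by (subst sum.swap) (intro sum.cong refl count)
  finally show ?thesis
    using r0 by (simp add: q_def sum_distrib_left[symmetric])
qed

section \<open>Measure-preserving actions of the free group\<close>

locale free_group_pmp_action = prob_space M for M :: "'x measure" +
  fixes r :: nat and \<alpha> :: "letter list \<Rightarrow> 'x \<Rightarrow> 'x"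
  assumes rank: "2 \<le> r" and pmp: "pmp_action (free_group r) M \<alpha>"
begin

sublocale action: group_action "free_group r" "space M" \<alpha>
  using pmp by (simp add: pmp_action_def)

lemma act_measurable: "w \<in> carrier (free_group r) \<Longrightarrow> \<alpha> w \<in> measurable M M"
  using pmp by (simp add: pmp_action_def)

lemma act_distr: "w \<in> carrier (free_group r) \<Longrightarrow> distr M M (\<alpha> w) = M"
  using pmp by (simp add: pmp_action_def)

lemma act_space: "w \<in> carrier (free_group r) \<Longrightarrow> x \<in> space M \<Longrightarrow> \<alpha> w x \<in> space M"
  using act_measurable measurable_space by metis

lemma act_append:
  assumes "u @ v \<in> carrier (free_group r)" "x \<in> space M"
  shows "\<alpha> (u @ v) x = \<alpha> u (\<alpha> v x)"
proof -
  have "u \<in> carrier (free_group r)" "v \<in> carrier (free_group r)"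
    using assms by (auto simp: free_group_def reduced_word_def successively_append_iff)
  then show ?thesis
    using action.composition_rule[of x u v] assms by (simp add: mult_append)
qed

lemma act_Nil: "x \<in> space M \<Longrightarrow> \<alpha> [] x = x"
  using fun_cong[OF action.id_eq_one, of x] by (simp add: free_group_def)

lemma integrable_act:
  "w \<in> carrier (free_group r) \<Longrightarrow> integrable M (h :: 'x \<Rightarrow> real) \<Longrightarrow> integrable M (\<lambda>x. h (\<alpha> w x))"
  using act_measurable act_distr by (metis integrable_distr)

lemma integral_act:
  assumes "w \<in> carrier (free_group r)" "(h :: 'x \<Rightarrow> real) \<in> borel_measurable M"
  shows "(\<integral>x. h (\<alpha> w x) \<partial>M) = (\<integral>x. h x \<partial>M)"
  using integral_distr[OF act_measurable[OF assms(1)] assms(2)] act_distr[OF assms(1)] by simp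

lemma AE_act:
  assumes "w \<in> carrier (free_group r)" "AE x in M. P x"
  shows "AE x in M. P (\<alpha> w x)"
proof (rule AE_distrD[OF act_measurable[OF assms(1)]])
  show "AE x in distr M M (\<alpha> w). P x"
    unfolding act_distr[OF assms(1)] by (rule assms(2))
qed

section \<open>The optimal tree sum and the maximal inequality\<close>

text \<open>The largest sum \<open>\<Sum>w\<in>T. h (\<alpha> w x) / (2r - 1)\<^sup>|\<^sup>w\<^sup>|\<close> over trees \<open>T\<close> below \<open>b\<close> all of whose words are shorter
  than \<open>n\<close>: the best tree is either empty or consists of its root and a best tree in each branch.
  The recursion makes measurability and integrability evident.\<close>

primrec best_tree_sum :: "('x \<Rightarrow> real) \<Rightarrow> nat \<Rightarrow> letter \<Rightarrow> 'x \<Rightarrow> real" where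
  "best_tree_sum h 0 b x = 0"
| "best_tree_sum h (Suc n) b x =
     max 0 (h x + (\<Sum>a\<in>next_letters r b. best_tree_sum h n a (\<alpha> [a] x)) / (2 * real r - 1))"

lemma q_pos: "2 * real r - 1 > 0"
  using rank by simp

lemma best_tree_sum_nonneg: "0 \<le> best_tree_sum h n b x"
  by (cases n) auto

lemma best_tree_sum_mono_Suc: "best_tree_sum h n b x \<le> best_tree_sum h (Suc n) b x"
proof (induction n arbitrary: b x)
  case (Suc n)
  have "(\<Sum>a\<in>next_letters r b. best_tree_sum h n a (\<alpha> [a] x)) \<le> (\<Sum>a\<in>next_letters r b. best_tree_sum h (Suc n) a (\<alpha> [a] x))"
    by (intro sum_mono Suc)
  then have "h x + (\<Sum>a\<in>next_letters r b. best_tree_sum h n a (\<alpha> [a] x)) / (2 * real r - 1)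
     \<le> h x + (\<Sum>a\<in>next_letters r b. best_tree_sum h (Suc n) a (\<alpha> [a] x)) / (2 * real r - 1)"
    using q_pos by (intro add_left_mono divide_right_mono) auto
  then show ?case
    by (subst (1 2) best_tree_sum.simps(2)) (rule max.mono[OF order_refl])
qed (simp add: best_tree_sum_nonneg del: best_tree_sum.simps(2))

lemma best_tree_sum_mono: "m \<le> n \<Longrightarrow> best_tree_sum h m b x \<le> best_tree_sum h n b x"
  using lift_Suc_mono_le[of "\<lambda>n. best_tree_sum h n b x"] best_tree_sum_mono_Suc by blast

lemma integrable_best_tree_sum:
  assumes "integrable M h"
  shows "integrable M (best_tree_sum h n b)"
proof (induction n arbitrary: b)
  case (Suc n)
  have "integrable M (\<lambda>x. max 0 (h x + (\<Sum>a\<in>next_letters r b. best_tree_sum h n a (\<alpha> [a] x)) / (2 * real r - 1)))"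
    by (intro integrable_max integrable_zero Bochner_Integration.integrable_add assms
        Bochner_Integration.integrable_divide Bochner_Integration.integrable_sum integrable_act
        Suc singleton_in_free_group)
      (auto simp: next_letters_iff)
  then show ?case by simp
next
  case 0
  have "best_tree_sum h 0 b = (\<lambda>_. 0)" by (rule ext) simp
  then show ?case by simp
qed

text \<open>A tree never leaves the orbit of its base point, so an invariant set cuts down the optimal sum
  just as it cuts down \<open>h\<close>.\<close>

lemma best_tree_sum_indicator:
  assumes inv: "\<And>a x. a \<in> letters r \<Longrightarrow> x \<in> space M \<Longrightarrow> \<alpha> [a] x \<in> D \<longleftrightarrow> x \<in> D"
    and "x \<in> space M"
  shows "best_tree_sum (\<lambda>x. indicator D x * h x) n b x = indicator D x * best_tree_sum h n b x"
  using assms(2)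
proof (induction n arbitrary: b x)
  case (Suc n)
  have "(\<Sum>a\<in>next_letters r b. best_tree_sum (\<lambda>x. indicator D x * h x) n a (\<alpha> [a] x))
      = (\<Sum>a\<in>next_letters r b. indicator D x * best_tree_sum h n a (\<alpha> [a] x))"
    using Suc inv act_space singleton_in_free_group
    by (intro sum.cong refl) (auto simp: next_letters_iff indicator_def)
  then show ?case
    by (auto simp: indicator_def)
qed simp

text \<open>The Markov operator \<open>(P g) b x = (\<Sum>a\<in>next_letters r b. g a (\<alpha> [a] x)) / (2r - 1)\<close> preserves the integral
  over \<open>letters r \<times> X\<close>, since every letter is a possible successor of exactly \<open>2r - 1\<close> letters.\<close>

lemma sum_integral_next_letters:
  assumes "\<And>a. integrable M (g a)"
  shows "(\<Sum>b\<in>letters r. \<integral>x. (\<Sum>a\<in>next_letters r b. g a (\<alpha> [a] x)) / (2 * real r - 1) \<partial>M)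
       = (\<Sum>b\<in>letters r. \<integral>x. (g b x :: real) \<partial>M)"
proof -
  let ?q = "2 * real r - 1"
  have "(\<integral>x. (\<Sum>a\<in>next_letters r b. g a (\<alpha> [a] x)) / ?q \<partial>M)
      = (\<Sum>a\<in>letters r. if a \<in> next_letters r b then (\<integral>x. g a x \<partial>M) / ?q else 0)" for b
  proof -
    have "(\<integral>x. (\<Sum>a\<in>next_letters r b. g a (\<alpha> [a] x)) / ?q \<partial>M)
        = (\<Sum>a\<in>next_letters r b. (\<integral>x. g a (\<alpha> [a] x) \<partial>M)) / ?q"
    proof -
      have "integrable M (\<lambda>x. g a (\<alpha> [a] x))" if "a \<in> next_letters r b" for a
        using that assms by (intro integrable_act singleton_in_free_group) (auto simp: next_letters_iff)
      then show ?thesis by (simp add: Bochner_Integration.integral_sum)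
    qed
    also have "\<dots> = (\<Sum>a\<in>next_letters r b. (\<integral>x. g a x \<partial>M) / ?q)"
      unfolding sum_divide_distrib
    proof (rule sum.cong[OF refl])
      fix a assume "a \<in> next_letters r b"
      then have "[a] \<in> carrier (free_group r)"
        by (simp add: singleton_in_free_group next_letters_iff)
      moreover have "g a \<in> borel_measurable M" using assms by blast
      ultimately show "(\<integral>x. g a (\<alpha> [a] x) \<partial>M) / ?q = (\<integral>x. g a x \<partial>M) / ?q"
        by (simp add: integral_act)
    qed
    also have "\<dots> = (\<Sum>a\<in>letters r. if a \<in> next_letters r b then (\<integral>x. g a x \<partial>M) / ?q else 0)"
      by (rule sum.mono_neutral_cong_left) (auto simp: finite_letters next_letters_iff)
    finally show ?thesis .
  qed
  then have "(\<Sum>b\<in>letters r. \<integral>x. (\<Sum>a\<in>next_letters r b. g a (\<alpha> [a] x)) / ?q \<partial>M)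
     = (\<Sum>b\<in>letters r. \<Sum>a\<in>letters r. if a \<in> next_letters r b then (\<integral>x. g a x \<partial>M) / ?q else 0)"
    by (rule sum.cong[OF refl])
  also have "\<dots> = (\<Sum>a\<in>letters r. \<Sum>b\<in>letters r. if a \<in> next_letters r b then (\<integral>x. g a x \<partial>M) / ?q else 0)"
    by (rule sum.swap)
  also have "\<dots> = (\<Sum>a\<in>letters r. \<integral>x. g a x \<partial>M)"
  proof (intro sum.cong refl)
    fix a assume a: "a \<in> letters r"
    have "(\<Sum>b\<in>letters r. if a \<in> next_letters r b then (\<integral>x. g a x \<partial>M) / ?q else 0)
       = (\<Sum>b\<in>next_letters r a. (\<integral>x. g a x \<partial>M) / ?q)"
      by (rule sum.mono_neutral_cong_right)
        (use a in \<open>auto simp: finite_letters next_letters_iff\<close>)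
    also have "\<dots> = (\<integral>x. g a x \<partial>M)"
      using card_next_letters[OF a] q_pos by simp
    finally show "(\<Sum>b\<in>letters r. if a \<in> next_letters r b then (\<integral>x. g a x \<partial>M) / ?q else 0)
       = (\<integral>x. g a x \<partial>M)" .
  qed
  finally show ?thesis .
qed

text \<open>Hopf's maximal ergodic lemma for trees.\<close>

lemma maximal_inequality:
  assumes h: "integrable M h"
  shows "0 \<le> (\<Sum>b\<in>letters r. \<integral>x. h x * indicator {x. best_tree_sum h n b x > 0} x \<partial>M)"
proof -
  let ?P = "\<lambda>b x. (\<Sum>a\<in>next_letters r b. best_tree_sum h n a (\<alpha> [a] x)) / (2 * real r - 1)"
  have int_ind: "integrable M (\<lambda>x. h x * indicator {x. best_tree_sum h n b x > 0} x)" for b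
  proof (rule Bochner_Integration.integrable_bound[OF h])
    have "best_tree_sum h n b \<in> borel_measurable M" using integrable_best_tree_sum[OF h] by blast
    then have "Measurable.pred M (\<lambda>x. best_tree_sum h n b x > 0)" by measurable
    then have "(\<lambda>x. h x * (if best_tree_sum h n b x > 0 then 1 else 0)) \<in> borel_measurable M"
      using h by measurable
    then show "(\<lambda>x. h x * indicator {x. best_tree_sum h n b x > 0} x) \<in> borel_measurable M"
      by (simp add: indicator_def of_bool_def)
  qed (auto simp: indicator_def)
  have int_P: "integrable M (?P b)" for b
    by (intro Bochner_Integration.integrable_divide Bochner_Integration.integrable_sum
        integrable_act integrable_best_tree_sum h singleton_in_free_group) (auto simp: next_letters_iff)
  \<comment> \<open>Summing the integrals of this inequality over \<open>b\<close> makes the left-hand side vanish.\<close>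
  have pointwise: "best_tree_sum h n b x - ?P b x \<le> h x * indicator {x. best_tree_sum h n b x > 0} x" for b x
  proof (cases "best_tree_sum h n b x > 0")
    case True
    have "best_tree_sum h n b x \<le> max 0 (h x + ?P b x)"
      using best_tree_sum_mono_Suc[of h n b x] by simp
    with True show ?thesis by auto
  next
    case False
    then have "best_tree_sum h n b x = 0" using best_tree_sum_nonneg[of h n b x] by simp
    moreover have "0 \<le> ?P b x" using q_pos by (intro divide_nonneg_pos sum_nonneg best_tree_sum_nonneg)
    ultimately show ?thesis by simp
  qed
  have "0 = (\<Sum>b\<in>letters r. \<integral>x. best_tree_sum h n b x \<partial>M) - (\<Sum>b\<in>letters r. \<integral>x. ?P b x \<partial>M)"
    using sum_integral_next_letters[of "best_tree_sum h n"] integrable_best_tree_sum[OF h] by simp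
  also have "\<dots> = (\<Sum>b\<in>letters r. \<integral>x. best_tree_sum h n b x - ?P b x \<partial>M)"
    by (simp add: Bochner_Integration.integral_diff[OF integrable_best_tree_sum[OF h] int_P] sum_subtractf)
  also have "\<dots> \<le> (\<Sum>b\<in>letters r. \<integral>x. h x * indicator {x. best_tree_sum h n b x > 0} x \<partial>M)"
    by (intro sum_mono integral_mono Bochner_Integration.integrable_diff integrable_best_tree_sum int_P int_ind h pointwise)
  finally show ?thesis .
qed

section \<open>The set where optimal tree sums are unbounded\<close>

text \<open>Unboundedness, unlike positivity, of the optimal sums is insensitive to the bounded
  contribution of the root of a tree, and so passes from a state to its predecessors.\<close>

definition explosive :: "('x \<Rightarrow> real) \<Rightarrow> letter \<Rightarrow> 'x set" where
  "explosive h b = {x \<in> space M. \<forall>C::nat. \<exists>n. best_tree_sum h n b x > real C}"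

lemma explosive_measurable:
  assumes "integrable M h"
  shows "explosive h b \<in> sets M"
proof -
  have [measurable]: "best_tree_sum h n b \<in> borel_measurable M" for n
    using integrable_best_tree_sum[OF assms] by blast
  show ?thesis unfolding explosive_def by measurable
qed

text \<open>A tree at \<open>\<alpha> [a] x\<close> extends to a tree at \<open>x\<close> by adding the root and leaving the other branches
  empty. This changes its sum by the factor \<open>1 / (2r - 1)\<close> and the summand \<open>h x\<close>.\<close>

lemma explosive_parent:
  assumes x: "x \<in> space M" and a: "a \<in> next_letters r b" and ex: "\<alpha> [a] x \<in> explosive h a"
  shows "x \<in> explosive h b"
  unfolding explosive_def
proof (intro CollectI conjI x allI)
  fix C :: nat
  let ?q = "2 * real r - 1"
  obtain K :: nat where K: "real K \<ge> ?q * (real C - h x)" using real_arch_simple by blast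
  obtain n where n: "best_tree_sum h n a (\<alpha> [a] x) > real K" using ex by (auto simp: explosive_def)
  have "best_tree_sum h n a (\<alpha> [a] x) \<le> (\<Sum>a\<in>next_letters r b. best_tree_sum h n a (\<alpha> [a] x))"
    by (rule member_le_sum[OF a]) (auto simp: best_tree_sum_nonneg finite_next_letters)
  then have "?q * (real C - h x) < (\<Sum>a\<in>next_letters r b. best_tree_sum h n a (\<alpha> [a] x))"
    using K n by linarith
  then have "real C - h x < (\<Sum>a\<in>next_letters r b. best_tree_sum h n a (\<alpha> [a] x)) / ?q"
    using q_pos by (simp add: pos_less_divide_eq mult.commute)
  then have "best_tree_sum h (Suc n) b x > real C" by simp
  then show "\<exists>n. best_tree_sum h n b x > real C" by blast
qed

text \<open>The preimage of the explosive set of \<open>c\<close> under \<open>\<alpha> [c]\<close> is contained in that of \<open>d\<close> whenever \<open>c\<close>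
  may follow \<open>d\<close>, and it has the same measure as the explosive set of \<open>c\<close>. As any two letters are
  linked by a common continuation, all the explosive sets have the same measure, so that these
  inclusions are equalities up to null sets.\<close>

lemma AE_explosive_step:
  assumes h: "integrable M h" and a: "a \<in> letters r" and b: "b \<in> letters r" "b' \<in> letters r"
  shows "AE x in M. x \<in> explosive h b \<longleftrightarrow> \<alpha> [a] x \<in> explosive h b'"
proof -
  let ?E = "explosive h"
  have E: "?E c \<in> sets M" for c by (rule explosive_measurable[OF h])
  have pull: "\<alpha> [c] -` ?E c \<inter> space M \<in> sets M"
    and pull_prob: "prob (\<alpha> [c] -` ?E c \<inter> space M) = prob (?E c)" if "c \<in> letters r" for c
  proof -
    have c: "[c] \<in> carrier (free_group r)" using that by (rule singleton_in_free_group)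
    show "\<alpha> [c] -` ?E c \<inter> space M \<in> sets M"
      using act_measurable[OF c] E by (rule measurable_sets)
    show "prob (\<alpha> [c] -` ?E c \<inter> space M) = prob (?E c)"
      using measure_distr[OF act_measurable[OF c] E] act_distr[OF c] by simp
  qed
  have sub: "\<alpha> [c] -` ?E c \<inter> space M \<subseteq> ?E d" if "c \<in> next_letters r d" for c d
    using explosive_parent that by blast
  have le: "prob (?E c) \<le> prob (?E d)" if "c \<in> next_letters r d" for c d
    using finite_measure_mono[OF sub[OF that] E] that pull_prob by (simp add: next_letters_iff)
  have le_all: "prob (?E c) \<le> prob (?E d)" if "c \<in> letters r" for c d
  proof -
    obtain e where "e \<in> next_letters r c" "e \<in> next_letters r d"
      using obtain_common_next_letter[OF rank] by metis
    then show ?thesis using le next_letters_swap that by (meson order_trans)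
  qed
  have step: "AE x in M. x \<in> ?E d \<longleftrightarrow> \<alpha> [c] x \<in> ?E c"
    if c: "c \<in> next_letters r d" and d: "d \<in> letters r" for c d
  proof -
    have cl: "c \<in> letters r" using c by (simp add: next_letters_iff)
    have "prob (?E d - (\<alpha> [c] -` ?E c \<inter> space M)) = prob (?E d) - prob (?E c)"
      using finite_measure_Diff[OF E pull[OF cl] sub[OF c]] pull_prob[OF cl] by simp
    also have "\<dots> = 0" using le_all[OF cl, of d] le_all[OF d, of c] by simp
    finally have "?E d - (\<alpha> [c] -` ?E c \<inter> space M) \<in> null_sets M"
      using E pull[OF cl] by (simp add: null_sets_def emeasure_eq_measure)
    then have "AE x in M. x \<notin> ?E d - (\<alpha> [c] -` ?E c \<inter> space M)" by (rule AE_not_in)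
    with AE_space show ?thesis
      by eventually_elim (use sub[OF c] in blast)
  qed
  have indep: "AE x in M. x \<in> ?E c \<longleftrightarrow> x \<in> ?E d" if "c \<in> letters r" "d \<in> letters r" for c d
  proof -
    obtain e where "e \<in> next_letters r c" "e \<in> next_letters r d"
      using obtain_common_next_letter[OF rank] by metis
    then have "AE x in M. x \<in> ?E c \<longleftrightarrow> \<alpha> [e] x \<in> ?E e" "AE x in M. x \<in> ?E d \<longleftrightarrow> \<alpha> [e] x \<in> ?E e"
      using step that by auto
    then show ?thesis by eventually_elim simp
  qed
  obtain d where "d \<in> next_letters r a" using obtain_common_next_letter[OF rank] by metis
  then have d: "d \<in> letters r" "a \<in> next_letters r d"
    using next_letters_swap[OF a] by (auto simp: next_letters_iff)
  have "AE x in M. \<alpha> [a] x \<in> ?E a \<longleftrightarrow> \<alpha> [a] x \<in> ?E b'"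
    using AE_act[OF singleton_in_free_group[OF a] indep[OF a b(2)]] .
  with indep[OF b(1) d(1)] step[OF d(2) d(1)] show ?thesis
    by eventually_elim simp
qed

lemma AE_explosive_orbit:
  assumes h: "integrable M h"
  shows "AE x in M. \<forall>w\<in>carrier (free_group r). \<forall>b\<in>letters r. \<forall>b'\<in>letters r.
    x \<in> explosive h b \<longrightarrow> \<alpha> w x \<in> explosive h b'"
proof -
  let ?E = "explosive h"
  let ?Q = "\<lambda>x. \<forall>a\<in>letters r. \<forall>b\<in>letters r. \<forall>b'\<in>letters r. x \<in> ?E b \<longleftrightarrow> \<alpha> [a] x \<in> ?E b'"
  have "AE x in M. ?Q x"
    by (intro AE_finite_allI finite_letters AE_explosive_step[OF h])
  then have "AE x in M. \<forall>w\<in>carrier (free_group r). ?Q (\<alpha> w x)"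
    by (intro AE_ball_countable' AE_act) auto
  with AE_space show ?thesis
  proof eventually_elim
    case (elim x)
    have "\<forall>b\<in>letters r. \<forall>b'\<in>letters r. x \<in> ?E b \<longrightarrow> \<alpha> w x \<in> ?E b'"
      if "w \<in> carrier (free_group r)" for w
      using that
    proof (induction w)
      case Nil
      obtain a where a: "a \<in> letters r"
        using obtain_common_next_letter[OF rank] by (metis next_letters_iff)
      have "?Q x" using elim Nil_in_free_group act_Nil by fastforce
      then show ?case using elim a act_Nil by simp
    next
      case (Cons a w)
      then have a: "a \<in> letters r" and w: "w \<in> carrier (free_group r)"
        using Cons_in_free_groupD by blast+
      have "\<alpha> (a # w) x = \<alpha> [a] (\<alpha> w x)"
        using act_append[of "[a]" w x] Cons.prems elim by simp
      then show ?case using Cons.IH[OF w] elim(2) w a by metis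
    qed
    then show ?case by blast
  qed
qed

text \<open>A strictly invariant set that agrees with every explosive set up to null sets; strict
  invariance is needed for membership in the invariant \<open>\<sigma>\<close>-algebra and in \<open>best_tree_sum_indicator\<close>.\<close>

definition explosive_core :: "('x \<Rightarrow> real) \<Rightarrow> 'x set" where
  "explosive_core h = {x \<in> space M. \<forall>w\<in>carrier (free_group r). \<forall>b\<in>letters r. \<alpha> w x \<in> explosive h b}"

lemma explosive_core_act:
  assumes "g \<in> carrier (free_group r)" "x \<in> explosive_core h"
  shows "\<alpha> g x \<in> explosive_core h"
proof -
  have x: "x \<in> space M" using assms by (simp add: explosive_core_def)
  have "\<alpha> w (\<alpha> g x) \<in> explosive h b" if "w \<in> carrier (free_group r)" "b \<in> letters r" for w b
  proof -
    have "w \<otimes>\<^bsub>free_group r\<^esub> g \<in> carrier (free_group r)"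
      using that assms group_free_group by (metis group.is_monoid monoid.m_closed)
    then show ?thesis
      using action.composition_rule[OF x that(1) assms(1)] assms(2) that
      by (auto simp: explosive_core_def)
  qed
  then show ?thesis using act_space assms x by (auto simp: explosive_core_def)
qed

lemma act_inv:
  assumes "g \<in> carrier (free_group r)" "x \<in> space M"
  shows "\<alpha> g (\<alpha> (inv\<^bsub>free_group r\<^esub> g) x) = x" "\<alpha> (inv\<^bsub>free_group r\<^esub> g) (\<alpha> g x) = x"
  using assms action.composition_rule act_Nil group_free_group
  by (metis (no_types, lifting) free_group_def group.inv_closed group.l_inv group.r_inv monoid.simps(2))+

lemma explosive_core_invariant:
  assumes h: "integrable M h"
  shows "explosive_core h \<in> sets (invariant_algebra (free_group r) M \<alpha>)"
proof -
  have ne: "carrier (free_group r) \<noteq> {}" "letters r \<noteq> {}"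
    using Nil_in_free_group rank by (auto simp: letters_def lessThan_empty_iff)
  have "explosive_core h = (\<Inter>w\<in>carrier (free_group r). \<Inter>b\<in>letters r. \<alpha> w -` explosive h b \<inter> space M)"
    using ne by (auto simp: explosive_core_def)
  also have "\<dots> \<in> sets M"
    using ne by (intro sets.countable_INT' sets.finite_INT finite_letters image_subsetI
        measurable_sets[OF act_measurable] explosive_measurable h) auto
  finally have meas: "explosive_core h \<in> sets M" .
  have "\<alpha> g ` explosive_core h = explosive_core h" if g: "g \<in> carrier (free_group r)" for g
  proof (intro subset_antisym subsetI)
    fix x assume x: "x \<in> explosive_core h"
    then have "x \<in> space M" by (simp add: explosive_core_def)
    then have "x = \<alpha> g (\<alpha> (inv\<^bsub>free_group r\<^esub> g) x)" using act_inv g by simp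
    moreover have "\<alpha> (inv\<^bsub>free_group r\<^esub> g) x \<in> explosive_core h"
      using explosive_core_act[OF _ x] g group_free_group by (metis group.inv_closed)
    ultimately show "x \<in> \<alpha> g ` explosive_core h" by blast
  qed (use explosive_core_act g in auto)
  then show ?thesis using meas by (simp add: sets_invariant_algebra[OF pmp])
qed


text \<open>The maximal inequality is applied to \<open>h\<close> restricted to the invariant core. On the core the
  optimal sums are eventually positive, and off the core the restricted function vanishes; so
  the integrals in the maximal inequality converge to the integral of the restricted function.\<close>

lemma integral_explosive_core_nonneg:
  assumes h: "integrable M h"
  shows "0 \<le> (\<integral>x. indicator (explosive_core h) x * h x \<partial>M)"
proof -
  let ?D = "explosive_core h"
  let ?H = "\<lambda>x. indicator ?D x * h x"
  have D: "?D \<in> sets M"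
    using explosive_core_invariant[OF h] by (simp add: sets_invariant_algebra[OF pmp])
  have D_act: "\<alpha> [a] x \<in> ?D \<longleftrightarrow> x \<in> ?D" if "a \<in> letters r" "x \<in> space M" for a x
  proof
    have a: "[a] \<in> carrier (free_group r)" using that by (simp add: singleton_in_free_group)
    then have a': "inv\<^bsub>free_group r\<^esub> [a] \<in> carrier (free_group r)"
      using group_free_group by (metis group.inv_closed)
    show "x \<in> ?D" if "\<alpha> [a] x \<in> ?D"
      using explosive_core_act[OF a' that] act_inv(2)[OF a \<open>x \<in> space M\<close>] by simp
    show "\<alpha> [a] x \<in> ?D" if "x \<in> ?D"
      using explosive_core_act[OF a that] .
  qed
  have H: "integrable M ?H" using integrable_mult_indicator[OF D h] by simp
  have lim: "(\<lambda>n. \<integral>x. ?H x * indicator {x. best_tree_sum ?H n b x > 0} x \<partial>M) \<longlonglongrightarrow> (\<integral>x. ?H x \<partial>M)"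
    if b: "b \<in> letters r" for b
  proof (rule integral_dominated_convergence[where w = "\<lambda>x. \<bar>h x\<bar>"])
    show "?H \<in> borel_measurable M" using H by blast
    show "(\<lambda>x. ?H x * indicator {x. best_tree_sum ?H n b x > 0} x) \<in> borel_measurable M" for n
    proof -
      have "best_tree_sum ?H n b \<in> borel_measurable M" using integrable_best_tree_sum[OF H] by blast
      then have "Measurable.pred M (\<lambda>x. best_tree_sum ?H n b x > 0)" by measurable
      moreover have "?H \<in> borel_measurable M" using H by blast
      ultimately have "(\<lambda>x. ?H x * (if best_tree_sum ?H n b x > 0 then 1 else 0)) \<in> borel_measurable M"
        by measurable
      then show ?thesis by (simp add: indicator_def of_bool_def)
    qed
    show "integrable M (\<lambda>x. \<bar>h x\<bar>)" using h by simp
    show "AE x in M. norm (?H x * indicator {x. best_tree_sum ?H n b x > 0} x) \<le> \<bar>h x\<bar>" for n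
      by (auto simp: indicator_def)
    have "(\<lambda>n. ?H x * indicator {x. best_tree_sum ?H n b x > 0} x) \<longlonglongrightarrow> ?H x" if x: "x \<in> space M" for x
    proof (cases "x \<in> ?D")
      case True
      then have "x \<in> explosive h b"
        using Nil_in_free_group[of r] act_Nil[OF x] b by (force simp: explosive_core_def)
      then obtain n0 where n0: "best_tree_sum h n0 b x > 0" 
        unfolding explosive_def by (auto dest: spec[of _ "0::nat"])
      have "best_tree_sum ?H n b x > 0" if "n \<ge> n0" for n
        using best_tree_sum_mono[OF that, of h b x] n0 True best_tree_sum_indicator[OF D_act x, of h n b] by simp
      then have "eventually (\<lambda>n. ?H x * indicator {x. best_tree_sum ?H n b x > 0} x = ?H x) sequentially"
        by (intro eventually_sequentiallyI[of n0]) simp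
      then show ?thesis by (rule tendsto_eventually)
    qed simp
    then show "AE x in M. (\<lambda>n. ?H x * indicator {x. best_tree_sum ?H n b x > 0} x) \<longlonglongrightarrow> ?H x"
      by (rule AE_I2)
  qed
  have "(\<lambda>n. \<Sum>b\<in>letters r. \<integral>x. ?H x * indicator {x. best_tree_sum ?H n b x > 0} x \<partial>M)
      \<longlonglongrightarrow> (\<Sum>b\<in>letters r. \<integral>x. ?H x \<partial>M)"
    by (intro tendsto_sum lim)
  then have "0 \<le> (\<Sum>b\<in>letters r. \<integral>x. ?H x \<partial>M)"
    by (rule LIMSEQ_le_const) (use maximal_inequality[OF H] in blast)
  then show ?thesis
    using rank by (simp add: card_letters zero_le_mult_iff)
qed

text \<open>If \<open>D\<close> is the core of \<open>u - c\<close>, then the integral of \<open>u - c\<close> over \<open>D\<close> equals \<open>- c \<mu>(D)\<close>, and it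
  is nonnegative by the preceding lemma; so \<open>D\<close> is null, and almost every orbit that meets an
  explosive set lies in \<open>D\<close>.\<close>

lemma AE_not_explosive:
  assumes u: "integrable M u"
    and zero: "\<And>D. D \<in> sets (invariant_algebra (free_group r) M \<alpha>) \<Longrightarrow> (\<integral>x. indicator D x * u x \<partial>M) = 0"
    and c: "c > 0"
  shows "AE x in M. \<forall>b\<in>letters r. x \<notin> explosive (\<lambda>x. u x - c) b"
proof -
  let ?h = "\<lambda>x. u x - c"
  let ?D = "explosive_core ?h"
  have h: "integrable M ?h" using u by simp
  have D: "?D \<in> sets M"
    using explosive_core_invariant[OF h] by (simp add: sets_invariant_algebra[OF pmp])
  have "0 \<le> (\<integral>x. indicator ?D x * u x - indicator ?D x * c \<partial>M)"
    using integral_explosive_core_nonneg[OF h] by (simp add: right_diff_distrib)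
  also have "\<dots> = (\<integral>x. indicator ?D x * u x \<partial>M) - (\<integral>x. indicator ?D x * c \<partial>M)"
    using integrable_mult_indicator[OF D u] integrable_mult_indicator[OF D, of "\<lambda>_. c"]
    by (intro Bochner_Integration.integral_diff) simp_all
  also have "\<dots> = - c * prob ?D"
    using zero[OF explosive_core_invariant[OF h]] D by simp
  finally have "prob ?D = 0"
    using c measure_nonneg[of M ?D] by (simp add: mult_le_0_iff)
  then have "?D \<in> null_sets M" using D by (simp add: null_sets_def emeasure_eq_measure)
  then have "AE x in M. x \<notin> ?D" by (rule AE_not_in)
  with AE_space AE_explosive_orbit[OF h] show ?thesis
    by eventually_elim (auto simp: explosive_core_def)
qed

section \<open>Sums over trees\<close>

lemma backward_tree_sum_le_best_tree_sum:
  assumes "backward_tree r b T" "\<And>w. w \<in> T \<Longrightarrow> length w < n" "x \<in> space M"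
  shows "(\<Sum>w\<in>T. h (\<alpha> w x) / (2 * real r - 1) ^ length w) \<le> best_tree_sum h n b x"
  using assms
proof (induction n arbitrary: b T x)
  case 0
  then have "T = {}" by auto
  then show ?case by simp
next
  case (Suc n)
  let ?q = "2 * real r - 1"
  show ?case
  proof (cases "T = {}")
    case True
    then show ?thesis using best_tree_sum_nonneg by (simp del: best_tree_sum.simps)
  next
    case False
    have branch: "(\<Sum>w\<in>{w. w @ [a] \<in> T}. h (\<alpha> (w @ [a]) x) / ?q ^ length (w @ [a]))
        \<le> best_tree_sum h n a (\<alpha> [a] x) / ?q" if a: "a \<in> next_letters r b" for a
    proof -
      let ?T = "{w. w @ [a] \<in> T}"
      have T: "backward_tree r a ?T" by (rule backward_tree_branch[OF Suc.prems(1)])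
      have "[a] \<in> carrier (free_group r)"
        using a by (simp add: singleton_in_free_group next_letters_iff)
      then have x: "\<alpha> [a] x \<in> space M" using act_space Suc.prems(3) by blast
      have "\<alpha> (w @ [a]) x = \<alpha> w (\<alpha> [a] x)" if "w \<in> ?T" for w
        using that T Suc.prems(3) by (intro act_append) (auto simp: backward_tree_def)
      then have "(\<Sum>w\<in>?T. h (\<alpha> (w @ [a]) x) / ?q ^ length (w @ [a]))
          = (\<Sum>w\<in>?T. h (\<alpha> w (\<alpha> [a] x)) / ?q ^ length w) / ?q"
        unfolding sum_divide_distrib by (intro sum.cong refl) (simp add: mult.commute)
      also have "\<dots> \<le> best_tree_sum h n a (\<alpha> [a] x) / ?q"
        using q_pos Suc.prems(2) by (intro divide_right_mono Suc.IH T x) fastforce+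
      finally show ?thesis .
    qed
    have "(\<Sum>w\<in>T. h (\<alpha> w x) / ?q ^ length w) = h x + (\<Sum>a\<in>next_letters r b.
        \<Sum>w\<in>{w. w @ [a] \<in> T}. h (\<alpha> (w @ [a]) x) / ?q ^ length (w @ [a]))"
      using sum_backward_tree_split[OF Suc.prems(1) False, of "\<lambda>w. h (\<alpha> w x) / ?q ^ length w"]
        act_Nil[OF Suc.prems(3)] by simp
    also have "\<dots> \<le> h x + (\<Sum>a\<in>next_letters r b. best_tree_sum h n a (\<alpha> [a] x)) / ?q"
      unfolding sum_divide_distrib by (intro add_left_mono sum_mono branch)
    finally show ?thesis by simp
  qed
qed

text \<open>The bound \<open>C\<close> depends on the point but not on the tree, which is what allows the sequence of
  trees to be chosen after the point.\<close>

lemma AE_tree_sum_bound: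
  assumes u: "integrable M u"
    and zero: "\<And>D. D \<in> sets (invariant_algebra (free_group r) M \<alpha>) \<Longrightarrow> (\<integral>x. indicator D x * u x \<partial>M) = 0"
    and c: "c > 0"
  shows "AE x in M. \<exists>C. \<forall>\<tau>. finite \<tau> \<and> subtree r \<tau> \<and> [] \<in> \<tau> \<longrightarrow>
    (\<Sum>w\<in>\<tau>. u (\<alpha> w x) * markov_u r w) \<le> c * markov_u_set r \<tau> + C"
proof -
  let ?h = "\<lambda>x. u x - c"
  have "AE x in M. \<forall>b\<in>letters r. x \<notin> explosive ?h b"
    by (rule AE_not_explosive) (fact u zero c)+
  with AE_space show ?thesis
  proof eventually_elim
    case (elim x)
    have "\<forall>b\<in>letters r. \<exists>C. \<forall>n. best_tree_sum ?h n b x \<le> C"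
      using elim unfolding explosive_def by (simp add: not_less) blast
    then obtain C where C: "\<And>b n. b \<in> letters r \<Longrightarrow> best_tree_sum ?h n b x \<le> C b" by metis
    have "(\<Sum>w\<in>\<tau>. u (\<alpha> w x) * markov_u r w) \<le> c * markov_u_set r \<tau> + (\<Sum>b\<in>letters r. C b) / (2 * real r)"
      if \<tau>: "finite \<tau>" "subtree r \<tau>" "[] \<in> \<tau>" for \<tau>
    proof -
      have sub: "\<tau> \<subseteq> carrier (free_group r)" using \<tau> by (simp add: subtree_def)
      have cl: "w \<in> \<tau>" if "a # w \<in> \<tau>" for a w
        using that subtree_iff_suffix_closed[OF sub \<tau>(3)] \<tau>(2) by blast
      obtain n where n: "\<And>w. w \<in> \<tau> \<Longrightarrow> length w < n"
        using finite_maxlen[OF \<tau>(1)] by blast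
      \<comment> \<open>The words of \<open>\<tau>\<close> that may precede \<open>b\<close> form a tree below \<open>b\<close>, whose sum is at most the optimal
        one and hence at most \<open>C b\<close>.\<close>
      have branch: "(\<Sum>w\<in>{w \<in> \<tau>. w @ [b] \<in> carrier (free_group r)}.
          ?h (\<alpha> w x) / (2 * real r - 1) ^ length w) \<le> C b" if b: "b \<in> letters r" for b
      proof -
        have "backward_tree r b {w \<in> \<tau>. w @ [b] \<in> carrier (free_group r)}"
          using \<tau>(1) cl Cons_in_free_groupD by (fastforce simp: backward_tree_def)
        from backward_tree_sum_le_best_tree_sum[OF this, of n x ?h] show ?thesis
          using n C[OF b, of n] elim(1) by fastforce
      qed
      have "(\<Sum>w\<in>\<tau>. u (\<alpha> w x) * markov_u r w) - c * markov_u_set r \<tau>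
          = (\<Sum>w\<in>\<tau>. ?h (\<alpha> w x) * markov_u r w)"
        by (simp add: markov_u_set_def left_diff_distrib sum_subtractf sum_distrib_left)
      also have "\<dots> \<le> (\<Sum>b\<in>letters r. C b) / (2 * real r)"
        unfolding sum_markov_u_eq_average[OF rank sub \<tau>(1)]
        by (intro divide_right_mono sum_mono branch) auto
      finally show ?thesis by simp
    qed
    then show ?case by blast
  qed
qed

text \<open>Here the equality holds at every point: the level sets of such a function are strictly
  invariant.\<close>

lemma invariant_function_act:
  assumes g: "(g :: 'x \<Rightarrow> real) \<in> borel_measurable (invariant_algebra (free_group r) M \<alpha>)"
    and w: "w \<in> carrier (free_group r)" and x: "x \<in> space M"
  shows "g (\<alpha> w x) = g x"
proof -
  let ?A = "g -` {g x} \<inter> space M"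
  have sp: "space (invariant_algebra (free_group r) M \<alpha>) = space M"
    using subalgebra_invariant_algebra[of M "free_group r" \<alpha>] by (simp add: subalgebra_def)
  have "?A \<in> sets (invariant_algebra (free_group r) M \<alpha>)"
    using measurable_sets[OF g, of "{g x}"] sp by simp
  then have "\<alpha> w ` ?A = ?A" using w by (simp add: sets_invariant_algebra[OF pmp])
  then have "\<alpha> w x \<in> ?A" using x by blast
  then show ?thesis by simp
qed

end

section \<open>The ergodic theorem along trees\<close>

theorem theorem1p1:
  fixes r :: nat and M :: "'x measure" and \<alpha> :: "letter list \<Rightarrow> 'x \<Rightarrow> 'x"
    and f :: "'x \<Rightarrow> real"
  assumes "2 \<le> r"
    and "prob_space M" and "standard_borel M"
    and "pmp_action (free_group r) M \<alpha>"
    and "integrable M f"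
  shows "AE x in M. \<forall>\<tau> :: nat \<Rightarrow> letter list set.
      (\<forall>n. finite (\<tau> n) \<and> subtree r (\<tau> n) \<and> \<one>\<^bsub>free_group r\<^esub> \<in> \<tau> n) \<longrightarrow>
      filterlim (\<lambda>n. markov_u_set r (\<tau> n)) at_top sequentially \<longrightarrow>
      (\<lambda>n. 1 / markov_u_set r (\<tau> n) * (\<Sum>w\<in>\<tau> n. f (\<alpha> w x) * markov_u r w))
        \<longlonglongrightarrow> real_cond_exp M (invariant_algebra (free_group r) M \<alpha>) f x"
proof -
  interpret prob_space M by fact
  interpret free_group_pmp_action M r \<alpha>
    using assms by unfold_locales
  let ?I = "invariant_algebra (free_group r) M \<alpha>"
  interpret finite_measure_subalgebra M ?I
    by unfold_locales (rule subalgebra_invariant_algebra)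
  note f = \<open>integrable M f\<close>
  define g where "g = real_cond_exp M ?I f"
  define u where "u = (\<lambda>x. f x - g x)"
  have g: "integrable M g" unfolding g_def by (rule real_cond_exp_int(1)[OF f])
  have u: "integrable M u" unfolding u_def using f g by simp
  have zero: "(\<integral>x. indicator D x * u x \<partial>M) = 0" if D: "D \<in> sets ?I" for D
  proof -
    have DM: "D \<in> sets M" using D subalg by (auto simp: subalgebra_def)
    have "(\<integral>x. indicator D x * u x \<partial>M) = (\<integral>x. indicator D x * f x \<partial>M) - (\<integral>x. indicator D x * g x \<partial>M)"
      unfolding u_def right_diff_distrib
      using integrable_mult_indicator[OF DM f] integrable_mult_indicator[OF DM g]
      by (intro Bochner_Integration.integral_diff) simp_all
    also have "\<dots> = 0"
      using real_cond_exp_intA[OF f D] by (simp add: set_lebesgue_integral_def g_def)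
    finally show ?thesis .
  qed
  have bound: "AE x in M. \<forall>k::nat. \<exists>C. \<forall>\<tau>. finite \<tau> \<and> subtree r \<tau> \<and> [] \<in> \<tau> \<longrightarrow>
    (\<Sum>w\<in>\<tau>. v (\<alpha> w x) * markov_u r w) \<le> 1 / real (Suc k) * markov_u_set r \<tau> + C"
    if "v = u \<or> v = (\<lambda>x. - u x)" for v
    unfolding AE_all_countable
    by (intro allI AE_tree_sum_bound) (use that u zero in auto)
  from AE_space bound[OF disjI1[OF refl]] bound[OF disjI2[OF refl]] show ?thesis
  proof eventually_elim
    case (elim x)
    show ?case
    proof (intro allI impI)
      fix \<tau> :: "nat \<Rightarrow> letter list set"
      assume tree: "\<forall>n. finite (\<tau> n) \<and> subtree r (\<tau> n) \<and> \<one>\<^bsub>free_group r\<^esub> \<in> \<tau> n"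
        and lim: "filterlim (\<lambda>n. markov_u_set r (\<tau> n)) at_top sequentially"
      define t where "t n = markov_u_set r (\<tau> n)" for n
      define s where "s n = (\<Sum>w\<in>\<tau> n. u (\<alpha> w x) * markov_u r w)" for n
      have \<tau>: "finite (\<tau> n)" "subtree r (\<tau> n)" "[] \<in> \<tau> n" for n
        using tree by (auto simp: free_group_def)
      have t_pos: "eventually (\<lambda>n. t n > 0) sequentially"
        using lim unfolding t_def by (rule eventually_compose_filterlim[OF eventually_gt_at_top])
      have "(\<lambda>n. s n / t n) \<longlonglongrightarrow> 0"
      proof (rule tendstoI)
        fix e :: real assume e: "e > 0"
        obtain k where k: "1 / real (Suc k) < e / 2"
          using reals_Archimedean[of "e / 2"] e by (auto simp: inverse_eq_divide)
        obtain C where C: "\<And>n. s n \<le> 1 / real (Suc k) * t n + C"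
          using elim(2)[rule_format, of k] \<tau> unfolding s_def t_def by blast
        obtain C' where C': "\<And>n. - s n \<le> 1 / real (Suc k) * t n + C'"
          using elim(3)[rule_format, of k] \<tau>
          unfolding s_def t_def mult_minus_left sum_negf by blast
        let ?K = "max C C'"
        have "eventually (\<lambda>n. t n > 2 * ?K / e) sequentially"
          using lim unfolding t_def by (rule eventually_compose_filterlim[OF eventually_gt_at_top])
        with t_pos show "eventually (\<lambda>n. dist (s n / t n) 0 < e) sequentially"
        proof eventually_elim
          case (elim n)
          have "1 / real (Suc k) * t n < e / 2 * t n"
            using k elim(1) by (intro mult_strict_right_mono)
          moreover have "?K < e / 2 * t n" using elim(2) e by (simp add: field_simps)
          moreover have "e / 2 * t n + e / 2 * t n = e * t n" by simp
          ultimately have "\<bar>s n\<bar> < e * t n" using C[of n] C'[of n] by linarith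
          then show ?case using elim(1) by (simp add: pos_divide_less_eq)
        qed
      qed
      then have "(\<lambda>n. g x + s n / t n) \<longlonglongrightarrow> g x"
        using tendsto_add[OF tendsto_const, of _ 0] by fastforce
      moreover have "eventually (\<lambda>n. g x + s n / t n =
          1 / t n * (\<Sum>w\<in>\<tau> n. f (\<alpha> w x) * markov_u r w)) sequentially"
        using t_pos
      proof eventually_elim
        case (elim n)
        have "f (\<alpha> w x) = g x + u (\<alpha> w x)" if "w \<in> \<tau> n" for w
        proof -
          have "w \<in> carrier (free_group r)" using that \<tau>(2)[of n] by (auto simp: subtree_def)
          then have "g (\<alpha> w x) = g x"
            using \<open>x \<in> space M\<close> unfolding g_def
            by (intro invariant_function_act borel_measurable_cond_exp)
          then show ?thesis by (simp add: u_def)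
        qed
        then have "(\<Sum>w\<in>\<tau> n. f (\<alpha> w x) * markov_u r w) = g x * t n + s n"
          by (simp add: t_def s_def markov_u_set_def distrib_right sum.distrib sum_distrib_left)
        then show ?case using elim by (simp add: field_simps)
      qed
      ultimately have "(\<lambda>n. 1 / t n * (\<Sum>w\<in>\<tau> n. f (\<alpha> w x) * markov_u r w)) \<longlonglongrightarrow> g x"
        by (rule Lim_transform_eventually)
      then show "(\<lambda>n. 1 / markov_u_set r (\<tau> n) * (\<Sum>w\<in>\<tau> n. f (\<alpha> w x) * markov_u r w))
          \<longlonglongrightarrow> real_cond_exp M ?I f x"
        by (simp only: t_def g_def)
    qed
  qed
qed

end
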